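(* Let $\mathbb{K}$ be any field and $n$ a positive integer. Every quandle of cardinality $n$ admits an injective quandle homomorphism into $GLQ(\mathbb{K}^n)$.
   Context: A quandle is a non-empty set $X$ with a binary operation $\triangleleft$ such that: (Q1) $x\triangleleft x=x$ for all $x$; (Q2) for every $y\in X$ the map $x\mapsto x\triangleleft y$ is bijective; (Q3) $(x\triangleleft y)\triangleleft z=(x\triangleleft z)\triangleleft(y\triangleleft z)$ for all $x,y,z$. A quandle homomorphism is a map $f$ with $f(x\triangleleft x')=f(x)\triangleleft f(x')$. For a finite-dimensional vector space $V$ over $\mathbb{K}$, identified with a space of row vectors, let $GL(V)$ act on $V$ from the right by matrix multiplication, $v^A:=vA$. $GLQ(V)$ is the quandle with underlying set $V\times GL(V)$ and operation $$(v,A)\triangleleft(w,B):=(vA^{-1}B,\;B^{-1}AB).$$ *)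

theory Defs
  imports "HOL-Analysis.Analysis"
begin

locale quandle =
  fixes X :: "'a set" and tri :: "'a \<Rightarrow> 'a \<Rightarrow> 'a"  (infixl \<open>\<triangleleft>\<close> 70)
  assumes nonempty: "X \<noteq> {}"
    and idem: "x \<in> X \<Longrightarrow> x \<triangleleft> x = x"
    \<comment> \<open>bijectivity onto \<open>X\<close> also makes \<open>X\<close> closed under the operation\<close>
    and bij: "y \<in> X \<Longrightarrow> bij_betw (\<lambda>x. x \<triangleleft> y) X X"
    and self_distrib: "\<lbrakk>x \<in> X; y \<in> X; z \<in> X\<rbrakk> \<Longrightarrow> (x \<triangleleft> y) \<triangleleft> z = (x \<triangleleft> z) \<triangleleft> (y \<triangleleft> z)"

locale quandle_hom =
  dom: quandle X tri + cod: quandle Y tri'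
  for X :: "'a set" and tri :: "'a \<Rightarrow> 'a \<Rightarrow> 'a"  (infixl \<open>\<triangleleft>\<close> 70)
    and Y :: "'b set" and tri' :: "'b \<Rightarrow> 'b \<Rightarrow> 'b"  (infixl \<open>\<triangleleft>''\<close> 70) +
  fixes f :: "'a \<Rightarrow> 'b"
  assumes maps_to: "f \<in> X \<rightarrow> Y"
    and hom: "\<lbrakk>x \<in> X; y \<in> X\<rbrakk> \<Longrightarrow> f (x \<triangleleft> y) = f x \<triangleleft>' f y"

text \<open>
  The quandle \<open>GLQ(V)\<close> for the space \<open>V\<close> of row vectors indexed by \<open>'n\<close>, so that
  \<open>v v* A\<close> is the right action of \<open>A\<close> on \<open>v\<close>.
\<close>

definition GLQ :: "(('k::field ^ 'n) \<times> ('k ^ 'n ^ 'n)) set" where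
  "GLQ = UNIV \<times> {A. invertible A}"

definition GLQ_op :: "('k::field ^ 'n) \<times> ('k ^ 'n ^ 'n) \<Rightarrow> ('k ^ 'n) \<times> ('k ^ 'n ^ 'n) \<Rightarrow> ('k ^ 'n) \<times> ('k ^ 'n ^ 'n)" where
  "GLQ_op = (\<lambda>(v, A) (w, B). (v v* (matrix_inv A ** B), matrix_inv B ** A ** B))"

lemma matrix_inv_cancel:
  fixes A :: "'k::field^'n^'n"
  assumes "invertible A"
  shows "A ** matrix_inv A = mat 1" "matrix_inv A ** A = mat 1"
    "C ** A ** matrix_inv A = C" "C ** matrix_inv A ** A = C"
proof -
  show *: "A ** matrix_inv A = mat 1" "matrix_inv A ** A = mat 1"
    using someI_ex[OF assms[unfolded invertible_def]] by (simp_all add: matrix_inv_def)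
  show "C ** A ** matrix_inv A = C" "C ** matrix_inv A ** A = C"
    by (simp_all add: * flip: matrix_mul_assoc)
qed

lemma matrix_inv_eqI:
  fixes A :: "'k::field^'n^'n"
  assumes "A ** C = mat 1" "C ** A = mat 1"
  shows "matrix_inv A = C"
proof -
  have "invertible A" using assms by (auto simp: invertible_def)
  then have "matrix_inv A = C ** A ** matrix_inv A"
    by (simp add: assms)
  also have "\<dots> = C" by (rule matrix_inv_cancel) fact
  finally show ?thesis .
qed

lemma invertible_matrix_inv:
  fixes A :: "'k::field^'n^'n"
  assumes "invertible A"
  shows "invertible (matrix_inv A)"
  using matrix_inv_cancel[OF assms] by (auto simp: invertible_def)

lemma matrix_inv_conj:
  fixes A B :: "'k::field^'n^'n"
  assumes "invertible A" "invertible B"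
  shows "matrix_inv (matrix_inv B ** A ** B) = matrix_inv B ** matrix_inv A ** B"
    "matrix_inv (B ** A ** matrix_inv B) = B ** matrix_inv A ** matrix_inv B"
  by (rule matrix_inv_eqI; simp add: matrix_mul_assoc matrix_inv_cancel assms)+

lemma quandle_GLQ: "quandle (GLQ :: (('k::field ^ 'n) \<times> ('k ^ 'n ^ 'n)) set) GLQ_op"
proof
  show "GLQ \<noteq> ({} :: (('k ^ 'n) \<times> ('k ^ 'n ^ 'n)) set)"
    by (auto simp: GLQ_def invertible_def intro!: exI[of _ "mat 1"])
next
  fix x :: "('k ^ 'n) \<times> ('k ^ 'n ^ 'n)" assume "x \<in> GLQ"
  then show "GLQ_op x x = x"
    by (auto simp: GLQ_def GLQ_op_def matrix_inv_cancel)
next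
  fix y :: "('k ^ 'n) \<times> ('k ^ 'n ^ 'n)" assume "y \<in> GLQ"
  then obtain w B where y: "y = (w, B)" and B: "invertible B"
    by (auto simp: GLQ_def)
  define g :: "('k ^ 'n) \<times> ('k ^ 'n ^ 'n) \<Rightarrow> ('k ^ 'n) \<times> ('k ^ 'n ^ 'n)"
    where "g = (\<lambda>(v, A). (v v* (matrix_inv B ** (B ** A ** matrix_inv B)), B ** A ** matrix_inv B))"
  show "bij_betw (\<lambda>x. GLQ_op x y) GLQ GLQ"
    by (rule bij_betw_byWitness[where f' = g])
      (auto simp: y GLQ_def GLQ_op_def g_def B vector_matrix_mul_assoc matrix_mul_assoc
        matrix_inv_cancel matrix_inv_conj invertible_mult invertible_matrix_inv)
next
  fix x y z :: "('k ^ 'n) \<times> ('k ^ 'n ^ 'n)" assume "x \<in> GLQ" "y \<in> GLQ" "z \<in> GLQ"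
  then show "GLQ_op (GLQ_op x y) z = GLQ_op (GLQ_op x z) (GLQ_op y z)"
    by (auto simp: GLQ_def GLQ_op_def vector_matrix_mul_assoc matrix_mul_assoc
        matrix_inv_conj matrix_inv_cancel)
qed

end

theory Submission
  imports Defs
begin

text \<open>
  The embedding comes from the regular representation. Index a basis of \<open>K^n\<close> by the elements
  of the quandle and let \<open>P\<^sub>y\<close> be the permutation matrix of the right translation by \<open>y\<close>, so that
  \<open>e\<^sub>x P\<^sub>y = e\<^bsub>x \<triangleleft> y\<^esub>\<close> for row vectors. The map is \<open>x \<mapsto> (e\<^sub>x, P\<^sub>x)\<close>. Self-distributivity says exactly
  that \<open>P\<^sub>x P\<^sub>y = P\<^sub>y P\<^bsub>x \<triangleleft> y\<^esub>\<close>, which is the homomorphism law in the matrix component.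
  Idempotence says that \<open>e\<^sub>x\<close> is fixed by \<open>P\<^sub>x\<close>, hence by its inverse, so the twist by
  \<open>P\<^sub>x\<inverse>\<close> in the operation of \<open>GLQ\<close> disappears and the vector component of the product is
  \<open>e\<^sub>x P\<^sub>y = e\<^bsub>x \<triangleleft> y\<^esub>\<close>. The matrices alone may coincide for distinct elements (as in a trivial quandle);
  it is the basis vectors that make the map injective.
\<close>

definition function_matrix :: "('n \<Rightarrow> 'n) \<Rightarrow> 'k::field ^ 'n ^ 'n" where
  "function_matrix p = (\<chi> i j. if p i = j then 1 else 0)"

lemma axis_mult_function_matrix:
  "axis i 1 v* function_matrix p = (axis (p i) 1 :: 'k::field ^ 'n::finite)"
proof -
  have "axis i 1 v* M = M $ i" for M :: "'k ^ 'n ^ 'n"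
    by (simp add: vec_eq_iff vector_matrix_mult_def axis_def if_distrib[of "\<lambda>x. x * _"] cong: if_cong)
  then show ?thesis
    by (auto simp: vec_eq_iff function_matrix_def axis_def)
qed

text \<open>The order of the factors is reversed because row vectors are acted on from the right.\<close>

lemma function_matrix_mult:
  "function_matrix p ** function_matrix q
    = (function_matrix (q \<circ> p) :: 'k::field ^ 'n ^ 'n::finite)"
  by (simp add: vec_eq_iff matrix_matrix_mult_def function_matrix_def
      if_distrib[of "\<lambda>x. x * _"] cong: if_cong)

lemma function_matrix_id: "function_matrix id = (mat 1 :: 'k::field ^ 'n ^ 'n::finite)"
  by (simp add: vec_eq_iff function_matrix_def mat_def)

lemma invertible_function_matrix:
  assumes "bij p"
  shows "invertible (function_matrix p :: 'k::field ^ 'n ^ 'n::finite)"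
proof -
  have "inv p \<circ> p = id" "p \<circ> inv p = id"
    using assms by (auto simp: bij_def surj_iff)
  then show ?thesis
    unfolding invertible_def
    by (intro exI[of _ "function_matrix (inv p)"])
      (simp add: function_matrix_mult function_matrix_id)
qed

text \<open>
  Stated without inverses, the two conditions become equations between permutations when the
  matrices are permutation matrices.
\<close>

lemma GLQ_op_eqI:
  fixes A B C :: "'k::field ^ 'n ^ 'n"
  assumes "invertible A" "invertible B"
    and fixed: "v v* A = v" and commute: "A ** B = B ** C"
  shows "GLQ_op (v, A) (w, B) = (v v* B, C)"
proof -
  have "v v* matrix_inv A = v"
    by (metis fixed vector_matrix_mul_assoc matrix_inv_cancel(1)[OF assms(1)] vector_matrix_mul_rid)
  then have "v v* (matrix_inv A ** B) = v v* B"
    by (simp flip: vector_matrix_mul_assoc)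
  moreover have "matrix_inv B ** A ** B = C"
    by (metis commute matrix_mul_assoc matrix_inv_cancel(2)[OF assms(2)] matrix_mul_lid)
  ultimately show ?thesis
    by (simp add: GLQ_op_def)
qed

theorem theorem1p5:
  fixes X :: "'a set" and tri :: "'a \<Rightarrow> 'a \<Rightarrow> 'a"
  assumes "quandle X tri" and "card X = CARD('n::finite)"
  shows "\<exists>f. quandle_hom X tri (GLQ :: (('k::field ^ 'n) \<times> ('k ^ 'n ^ 'n)) set) GLQ_op f \<and> inj_on f X"
proof -
  interpret quandle X tri by fact
  have "finite X"
    using assms(2) by (metis card.infinite finite_UNIV_card_ge_0 finite less_irrefl)
  then obtain g :: "'a \<Rightarrow> 'n" where g: "bij_betw g X UNIV"
    using assms(2) by (metis finite_same_card_bij finite)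
  define h where "h = inv_into X g"
  have h: "bij_betw h UNIV X"
    unfolding h_def by (rule bij_betw_inv_into[OF g])
  have hX: "h i \<in> X" for i
    using h by (auto simp: bij_betw_def)
  have hg: "h (g x) = x" if "x \<in> X" for x
    unfolding h_def using bij_betw_inv_into_left[OF g that] .
  have closed: "tri x y \<in> X" if "x \<in> X" "y \<in> X" for x y
    using bij[OF that(2)] that(1) by (auto simp: bij_betw_def)

  define R where "R y = g \<circ> (\<lambda>x. tri x y) \<circ> h" for y
  have bij_R: "bij (R y)" if "y \<in> X" for y
    unfolding R_def by (intro bij_betw_trans[OF h] bij_betw_trans[OF bij[OF that]] g)
  define P where "P y = (function_matrix (R y) :: 'k ^ 'n ^ 'n)" for y
  define e where "e x = (axis (g x) 1 :: 'k ^ 'n)" for x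
  have inv_P: "invertible (P y)" if "y \<in> X" for y
    unfolding P_def by (rule invertible_function_matrix[OF bij_R[OF that]])
  have act: "e x v* P y = e (tri x y)" if "x \<in> X" "y \<in> X" for x y
    by (simp add: e_def P_def axis_mult_function_matrix R_def hg that)
  have commute: "P x ** P y = P y ** P (tri x y)" if "x \<in> X" "y \<in> X" for x y
  proof -
    have "R y \<circ> R x = R (tri x y) \<circ> R y"
      using self_distrib[OF hX that] by (simp add: fun_eq_iff R_def hg hX closed that)
    then show ?thesis
      by (simp add: P_def function_matrix_mult)
  qed

  have "quandle_hom X tri (GLQ :: (('k ^ 'n) \<times> ('k ^ 'n ^ 'n)) set) GLQ_op (\<lambda>x. (e x, P x))"
  proof (intro quandle_hom.intro quandle_hom_axioms.intro quandle_GLQ)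
    show "quandle X tri" by fact
    show "(\<lambda>x. (e x, P x)) \<in> X \<rightarrow> GLQ"
      by (auto simp: GLQ_def inv_P)
    show "(e (tri x y), P (tri x y)) = GLQ_op (e x, P x) (e y, P y)" if "x \<in> X" "y \<in> X" for x y
      using GLQ_op_eqI[OF inv_P inv_P _ commute, OF that _ that] act that idem by simp
  qed
  moreover have "inj_on (\<lambda>x. (e x, P x)) X"
    using g by (auto simp: inj_on_def e_def axis_eq_axis bij_betw_def)
  ultimately show ?thesis by blast
qed

end
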